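(* Let $F$ be a flat subset of edges of a strongly connected digraph $D^*=(V,A^* )$ with $|V|\ge 2$ and let $\mathcal K^*$ denote the set of di-circuits of $D^*$. Let $k\ge 2$ be an integer and $w:V\to\{0,1,2,\dots\}$ an integer-valued weight function. The maximum of $\sum_{v\in S}w(v)$ over all sets $S\subseteq V$ that are the $k$-union of $F$-stable sets of $D^*$ is equal to $$\min_{y:\mathcal K^*\to\mathbf Z_+}\Big\{k\sum_{K\in\mathcal K^*}y(K)\,|F\cap K|+\sum_{v\in V}\Big(w(v)-\sum_{K\in\mathcal K^*,\ v\in V(K)}y(K)\Big)^+\Big\}.$$ In particular, for a specified subset $U$ of nodes, the maximum cardinality of the $k$-union of $F$-stable subsets of $U$ is equal to $$\min_{\mathcal K\subseteq\mathcal K^*}\Big\{k\sum_{K\in\mathcal K}|F\cap K|+\Big|U-\bigcup_{K\in\mathcal K}V(K)\Big|\Big\}.$$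
   Context: Digraphs are finite and loopless; parallel and oppositely directed edges are allowed. $\mathbf Z_+$ is the set of non-negative integers and $x^+=\max\{x,0\}$. A di-circuit is a directed circuit (two oppositely directed edges between the same two nodes form a di-circuit); $K$ also denotes the edge-set of a di-circuit and $V(K)$ its node-set. An edge is cyclic if it belongs to a di-circuit. A subset $F$ of edges is flat if every cyclic edge belongs to a di-circuit containing exactly one element of $F$. A directed cut (dicut) of a digraph is the set of edges entering a subset $Z$ of nodes, provided no edge leaves $Z$. A sink node is a node with no leaving edge; a sink set is a set of nodes each of which is a sink. A set of nodes is sink-stable in a digraph if there are pairwise edge-disjoint dicuts of the digraph such that, after reversing the orientation of all edges of these dicuts, the set becomes a sink set. A set of nodes is $F$-stable in $D^*$ if it is sink-stable in the digraph arising from $D^*$ by reversing the edges in $F$. A set of nodes is a $k$-union of $F$-stable sets if it can be partitioned into $k$ (possibly empty) $F$-stable sets. *)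

theory Defs
  imports "Graph_Theory.Digraph_Component" "HOL-Library.Disjoint_Sets"
begin

text \<open>
  Multigraphs with parallel and oppositely directed edges are modelled by \<open>pre_digraph\<close>, where
  edges have their own identity. A di-circuit is identified with its edge-set; the library's
  \<open>cycle\<close> includes the two-edge circuits formed by a pair of oppositely directed edges.
\<close>

definition dicircuits :: "('a, 'b) pre_digraph \<Rightarrow> 'b set set" where
  "dicircuits G = {set p | p. pre_digraph.cycle G p}"

definition nodes_of :: "('a, 'b) pre_digraph \<Rightarrow> 'b set \<Rightarrow> 'a set" where
  "nodes_of G K = tail G ` K \<union> head G ` K"

definition cyclic_edge :: "('a, 'b) pre_digraph \<Rightarrow> 'b \<Rightarrow> bool" where
  "cyclic_edge G e \<longleftrightarrow> (\<exists>K \<in> dicircuits G. e \<in> K)"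

definition flat :: "('a, 'b) pre_digraph \<Rightarrow> 'b set \<Rightarrow> bool" where
  "flat G F \<longleftrightarrow> F \<subseteq> arcs G \<and>
     (\<forall>e \<in> arcs G. cyclic_edge G e \<longrightarrow> (\<exists>K \<in> dicircuits G. e \<in> K \<and> card (F \<inter> K) = 1))"

definition entering :: "('a, 'b) pre_digraph \<Rightarrow> 'a set \<Rightarrow> 'b set" where
  "entering G Z = {e \<in> arcs G. tail G e \<notin> Z \<and> head G e \<in> Z}"

definition leaving :: "('a, 'b) pre_digraph \<Rightarrow> 'a set \<Rightarrow> 'b set" where
  "leaving G Z = {e \<in> arcs G. tail G e \<in> Z \<and> head G e \<notin> Z}"

text \<open>
  \<open>Z\<close> is not required to be nonempty or proper: the empty edge-set thus counts as a dicut, which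
  is harmless, since reversing it changes nothing.
\<close>

definition dicut :: "('a, 'b) pre_digraph \<Rightarrow> 'b set \<Rightarrow> bool" where
  "dicut G C \<longleftrightarrow> (\<exists>Z \<subseteq> verts G. leaving G Z = {} \<and> C = entering G Z)"

definition reverse_edges :: "('a, 'b) pre_digraph \<Rightarrow> 'b set \<Rightarrow> ('a, 'b) pre_digraph" where
  "reverse_edges G R = G
     \<lparr> tail := (\<lambda>e. if e \<in> R then head G e else tail G e),
       head := (\<lambda>e. if e \<in> R then tail G e else head G e) \<rparr>"

definition sink_node :: "('a, 'b) pre_digraph \<Rightarrow> 'a \<Rightarrow> bool" where
  "sink_node G v \<longleftrightarrow> v \<in> verts G \<and> out_arcs G v = {}"

definition sink_set :: "('a, 'b) pre_digraph \<Rightarrow> 'a set \<Rightarrow> bool" where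
  "sink_set G S \<longleftrightarrow> (\<forall>v \<in> S. sink_node G v)"

definition sink_stable :: "('a, 'b) pre_digraph \<Rightarrow> 'a set \<Rightarrow> bool" where
  "sink_stable G S \<longleftrightarrow>
     (\<exists>\<C>. (\<forall>C \<in> \<C>. dicut G C) \<and> disjoint \<C> \<and> sink_set (reverse_edges G (\<Union>\<C>)) S)"

definition F_stable :: "('a, 'b) pre_digraph \<Rightarrow> 'b set \<Rightarrow> 'a set \<Rightarrow> bool" where
  "F_stable G F S \<longleftrightarrow> sink_stable (reverse_edges G F) S"

definition k_union_F_stable :: "('a, 'b) pre_digraph \<Rightarrow> 'b set \<Rightarrow> nat \<Rightarrow> 'a set \<Rightarrow> bool" where
  "k_union_F_stable G F k S \<longleftrightarrow>
     (\<exists>P :: nat \<Rightarrow> 'a set. (\<forall>i<k. F_stable G F (P i)) \<and>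
        disjoint_family_on P {..<k} \<and> S = (\<Union>i<k. P i))"

definition is_maximum :: "'c::linorder \<Rightarrow> 'c set \<Rightarrow> bool" where
  "is_maximum m X \<longleftrightarrow> m \<in> X \<and> (\<forall>x \<in> X. x \<le> m)"

definition is_minimum :: "'c::linorder \<Rightarrow> 'c set \<Rightarrow> bool" where
  "is_minimum m X \<longleftrightarrow> m \<in> X \<and> (\<forall>x \<in> X. m \<le> x)"

end

theory Submission
  imports Defs "HOL-Library.Multiset"
begin

text \<open>
  The proof turns stable sets into integer potentials and the min-max formula into the duality
  between such potentials and circulations.

  A family of disjoint dicuts of the digraph \<open>D\<close> obtained by reversing \<open>F\<close> amounts to an integer
  function \<open>\<pi>\<close> on the nodes that grows by 0 or 1 along each edge of \<open>D\<close>: the dicuts are the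
  boundaries of the level sets of \<open>\<pi>\<close>, and the edges to be reversed are those along which \<open>\<pi>\<close> grows.
  Expressed in \<open>G\<close> itself, with \<open>t(e) = \<pi>(head e) - \<pi>(tail e) + [e \<in> F]\<close>, the growth condition
  reads \<open>t(e) \<in> {0, 1}\<close>, and \<open>S\<close> becomes a sink set iff \<open>t = 1\<close> on the edges leaving a node of
  \<open>S\<close> and \<open>t = 0\<close> on the edges entering one. The sum of \<open>t\<close> over a di-circuit \<open>K\<close> is
  \<open>|F \<inter> K|\<close>, so an \<open>F\<close>-stable set meets \<open>K\<close> in at most \<open>|F \<inter> K|\<close> nodes
  (\<open>F_stable_dicircuit_bound\<close>); this gives the inequality max \<open>\<le>\<close> min. Flatness makes the lower
  bounds \<open>t(e) \<ge> [tail e \<in> S]\<close> sufficient: each edge lies on a di-circuit on which \<open>t\<close> sums to 1,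
  which forces the upper bounds (\<open>F_stable_of_potential\<close>). In the same way a set \<open>S\<close> is a
  \<open>k\<close>-union of \<open>F\<close>-stable sets as soon as \<open>\<pi>(tail e) + [tail e \<in> S] \<le> \<pi>(head e) + k [e \<in> F]\<close>
  for all edges, for one can divide the nodes of \<open>S\<close> according to the residue of \<open>\<pi>\<close> modulo \<open>k\<close>
  (\<open>k_union_of_potential\<close>).

  It remains to maximize a weight over such pairs \<open>(S, \<pi>)\<close>. Splitting each node into an entry and
  an exit copy turns this into maximizing a linear function under bounds on potential differences,
  the dual of a transshipment problem without capacities. If \<open>\<rho>\<close> is an optimal integer potential,
  raising \<open>\<rho>\<close> by 1 on a node set that no tight edge leaves cannot improve it, and this is exactly
  the condition for the transshipment to be feasible on the tight edges alone
  (\<open>transshipment\<close>, \<open>transshipment_duality\<close>). The resulting integer flow restricts to a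
  circulation of \<open>G\<close> whose cost plus the node weight it leaves uncovered is at most the maximum
  (\<open>covering_circulation_duality\<close>); decomposed into di-circuits, it is the wanted \<open>y\<close>.

  The unweighted formula follows by giving the nodes of \<open>U\<close> weight 1 and the others weight 0, and
  by replacing an optimal \<open>y\<close> with the set of di-circuits on which it is positive.
\<close>

section \<open>Flows and circulations\<close>

definition net_outflow :: "('a, 'b) pre_digraph \<Rightarrow> ('b \<Rightarrow> nat) \<Rightarrow> 'a \<Rightarrow> int" where
  "net_outflow G z v = (\<Sum>e\<in>out_arcs G v. int (z e)) - (\<Sum>e\<in>in_arcs G v. int (z e))"

lemma net_outflow_restrict_arcs:
  assumes "fin_digraph G" and "B \<subseteq> arcs G"
  shows "net_outflow G (\<lambda>e. if e \<in> B then z e else 0) v = net_outflow (G\<lparr>arcs := B\<rparr>) z v"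
proof -
  interpret fin_digraph G by fact
  have 1: "out_arcs (G\<lparr>arcs := B\<rparr>) v = {e \<in> out_arcs G v. e \<in> B}"
    and 2: "in_arcs (G\<lparr>arcs := B\<rparr>) v = {e \<in> in_arcs G v. e \<in> B}"
    using assms(2) by (auto simp: in_arcs_def out_arcs_def)
  have fin: "finite (out_arcs G v)" "finite (in_arcs G v)"
    by (auto simp: in_arcs_def out_arcs_def)
  show ?thesis
    unfolding net_outflow_def 1 2 sum.inter_filter[OF fin(1)] sum.inter_filter[OF fin(2)]
    by (simp add: if_distrib cong: if_cong)
qed

text \<open>
  Summation by parts, the identity behind every duality statement below: it exchanges node
  potentials and arc flows.
\<close>

lemma (in fin_digraph) sum_net_outflow_times:
  "(\<Sum>v\<in>verts G. net_outflow G z v * \<rho> v)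
     = (\<Sum>e\<in>arcs G. int (z e) * (\<rho> (tail G e) - \<rho> (head G e)))"
proof -
  have "(\<Sum>v\<in>verts G. (\<Sum>e\<in>out_arcs G v. int (z e)) * \<rho> v)
      = (\<Sum>v\<in>verts G. \<Sum>e\<in>{e \<in> arcs G. tail G e = v}. int (z e) * \<rho> (tail G e))"
    by (auto simp: out_arcs_def sum_distrib_right intro!: sum.cong)
  also have "\<dots> = (\<Sum>e\<in>arcs G. int (z e) * \<rho> (tail G e))"
    by (rule sum.group) auto
  finally have 1: "(\<Sum>v\<in>verts G. (\<Sum>e\<in>out_arcs G v. int (z e)) * \<rho> v)
      = (\<Sum>e\<in>arcs G. int (z e) * \<rho> (tail G e))" .
  have "(\<Sum>v\<in>verts G. (\<Sum>e\<in>in_arcs G v. int (z e)) * \<rho> v)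
      = (\<Sum>v\<in>verts G. \<Sum>e\<in>{e \<in> arcs G. head G e = v}. int (z e) * \<rho> (head G e))"
    by (auto simp: in_arcs_def sum_distrib_right intro!: sum.cong)
  also have "\<dots> = (\<Sum>e\<in>arcs G. int (z e) * \<rho> (head G e))"
    by (rule sum.group) auto
  finally have 2: "(\<Sum>v\<in>verts G. (\<Sum>e\<in>in_arcs G v. int (z e)) * \<rho> v)
      = (\<Sum>e\<in>arcs G. int (z e) * \<rho> (head G e))" .
  show ?thesis
    unfolding net_outflow_def left_diff_distrib right_diff_distrib sum_subtractf 1 2 ..
qed

text \<open>
  The flow entering a node set equals the flow leaving it; the proof sums the net outflow against
  the indicator of the complement of \<open>X\<close>.
\<close>

lemma (in fin_digraph) circulation_cut:
  assumes circ: "\<And>v. v \<in> verts G \<Longrightarrow> net_outflow G z v = 0"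
    and closed: "\<And>e. e \<in> leaving G X \<Longrightarrow> z e = 0"
    and e: "e \<in> entering G X"
  shows "z e = 0"
proof -
  let ?\<rho> = "\<lambda>v. if v \<in> X then 0 else 1 :: int"
  have "0 = (\<Sum>e\<in>arcs G. int (z e) * (?\<rho> (tail G e) - ?\<rho> (head G e)))"
    using sum_net_outflow_times[of z ?\<rho>] by (simp add: circ)
  moreover have nn: "0 \<le> int (z e) * (?\<rho> (tail G e) - ?\<rho> (head G e))" if "e \<in> arcs G" for e
    using closed[of e] that by (auto simp: leaving_def)
  ultimately have "int (z e) * (?\<rho> (tail G e) - ?\<rho> (head G e)) = 0"
    using e by (subst (asm) eq_commute, subst (asm) sum_nonneg_eq_0_iff) (auto simp: entering_def)
  with e show ?thesis by (auto simp: entering_def)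
qed

lemma (in fin_digraph) net_outflow_add:
  "net_outflow G (\<lambda>e. y e + z e) v = net_outflow G y v + net_outflow G z v"
  by (simp add: net_outflow_def sum.distrib)

lemma (in fin_digraph) net_outflow_single_arc:
  assumes "a \<in> arcs G"
  shows "net_outflow G (\<lambda>e. of_bool (e = a)) v = of_bool (v = tail G a) - of_bool (v = head G a)"
proof -
  have fin: "finite (out_arcs G v)" "finite (in_arcs G v)"
    by (auto simp: in_arcs_def out_arcs_def)
  show ?thesis
    using assms fin unfolding net_outflow_def
    by (auto simp: of_bool_def if_distrib sum.delta in_arcs_def out_arcs_def cong: if_cong)
qed

lemma (in fin_digraph) net_outflow_awalk:
  "awalk u p t \<Longrightarrow> net_outflow G (count_list p) v = of_bool (v = u) - of_bool (v = t)"
proof (induction p arbitrary: u)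
  case Nil
  then show ?case by (simp add: awalk_Nil_iff net_outflow_def)
next
  case (Cons a p)
  have a: "a \<in> arcs G" "u = tail G a" "awalk (head G a) p t"
    using Cons.prems by (auto simp: awalk_Cons_iff)
  have "count_list (a # p) = (\<lambda>e. of_bool (e = a) + count_list p e)"
    by auto
  then have "net_outflow G (count_list (a # p)) v
      = net_outflow G (\<lambda>e. of_bool (e = a)) v + net_outflow G (count_list p) v"
    by (simp only: net_outflow_add)
  also have "\<dots> = of_bool (v = u) - of_bool (v = t)"
    unfolding net_outflow_single_arc[OF a(1)] Cons.IH[OF a(3)] using a(2) by simp
  finally show ?case .
qed

text \<open>
  A supply in a set that no arc leaves cannot get out, so the condition is necessary; that it
  suffices resembles Hall's theorem. One unit is sent along a walk from a node \<open>s\<close> with positive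
  supply to a reachable node \<open>t\<close> with negative supply. This preserves the condition unless \<open>t\<close>
  lies in a closed set avoiding \<open>s\<close> whose total supply is already 0. Such tight sets are stable
  under union, and if their union \<open>Y\<close> contained all reachable nodes with negative supply, then
  adding to \<open>Y\<close> everything reachable from \<open>s\<close> would give a closed set of positive supply.
\<close>

lemma (in fin_digraph) transshipment:
  assumes "sum b (verts G) = (0 :: int)"
    and "\<And>X. X \<subseteq> verts G \<Longrightarrow> leaving G X = {} \<Longrightarrow> sum b X \<le> 0"
  shows "\<exists>z. \<forall>v\<in>verts G. net_outflow G z v = b v"
  using assms
proof (induction "nat (\<Sum>v\<in>verts G. \<bar>b v\<bar>)" arbitrary: b rule: less_induct)
  case less
  show ?case
  proof (cases "\<exists>s\<in>verts G. b s > 0")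
    case False
    then have "\<forall>v\<in>verts G. - b v = 0"
      using less.prems(1) by (subst sum_nonneg_eq_0_iff[symmetric]) (auto simp: sum_negf)
    then show ?thesis
      by (intro exI[of _ "\<lambda>_. 0"]) (auto simp: net_outflow_def)
  next
    case True
    then obtain s where s: "s \<in> verts G" "b s > 0" by blast
    define R where "R = {x. s \<rightarrow>\<^sup>* x}"
    have R: "R \<subseteq> verts G" "s \<in> R" "leaving G R = {}"
      using s(1) by (auto simp: R_def leaving_def dest: reachable_in_verts)
        (metis head_in_verts in_arcs_imp_in_arcs_ends reachable_adjI reachable_trans)
    \<comment> \<open>the tight closed sets that avoid \<open>s\<close>\<close>
    define \<T> where "\<T> = {X. X \<subseteq> verts G \<and> leaving G X = {} \<and> s \<notin> X \<and> sum b X = 0}"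
    have finite_\<T>: "finite \<T>"
      by (rule finite_subset[of _ "Pow (verts G)"]) (auto simp: \<T>_def)
    \<comment> \<open>both the union and the intersection have supply at most 0, and the two supplies add up to 0\<close>
    have un: "A \<union> B \<in> \<T>" if A: "A \<in> \<T>" and B: "B \<in> \<T>" for A B
    proof -
      have "finite A" "finite B"
        using A B by (auto simp: \<T>_def intro: finite_subset[OF _ finite_verts])
      then have "sum b (A \<union> B) + sum b (A \<inter> B) = 0"
        using A B sum.union_inter[of A B b] by (simp add: \<T>_def)
      moreover have "sum b (A \<union> B) \<le> 0" "sum b (A \<inter> B) \<le> 0"
        using A B by (auto simp: \<T>_def leaving_def intro!: less.prems(2))
      ultimately show ?thesis
        using A B by (auto simp: \<T>_def leaving_def)
    qed
    have Un: "\<Union>S \<in> \<T>" if "S \<subseteq> \<T>" for S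
      using finite_subset[OF that finite_\<T>] that
      by (induction S rule: finite_induct) (auto simp: un, simp add: \<T>_def leaving_def)
    define Y where "Y = \<Union>\<T>"
    have Y: "Y \<subseteq> verts G" "leaving G Y = {}" "s \<notin> Y" "sum b Y = 0"
      using Un[OF subset_refl] by (auto simp: Y_def \<T>_def)
    have "\<exists>t\<in>R. b t < 0 \<and> t \<notin> Y"
    proof (rule ccontr)
      assume no: "\<not> ?thesis"
      have fin: "finite (R - Y)" "finite Y" "finite R"
        using R(1) Y(1) by (auto intro: finite_subset[OF _ finite_verts])
      have "0 < sum b (R - Y)"
        using no R(2) Y(3) s(2) fin by (intro sum_pos2[of _ s]) auto
      moreover have "sum b (R \<union> Y) = sum b (R - Y) + sum b Y"
        using fin by (subst sum.union_disjoint[symmetric]) (auto intro: sum.cong)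
      moreover have "sum b (R \<union> Y) \<le> 0"
        using R Y by (intro less.prems(2)) (auto simp: leaving_def)
      ultimately show False using Y(4) by simp
    qed
    then obtain t where t: "t \<in> R" "b t < 0" "t \<notin> Y" by blast
    have tv: "t \<in> verts G" and st: "s \<noteq> t" using t s R by auto
    define b' where "b' v = b v - of_bool (v = s) + of_bool (v = t)" for v
    have sum_b': "sum b' X = sum b X - of_bool (s \<in> X) + of_bool (t \<in> X)" if "X \<subseteq> verts G" for X
    proof -
      have "finite X" using that finite_verts finite_subset by blast
      then show ?thesis
        by (auto simp: b'_def sum.distrib sum_subtractf of_bool_def)
    qed
    have "\<exists>z. \<forall>v\<in>verts G. net_outflow G z v = b' v"
    proof (rule less.hyps)
      have "(\<Sum>v\<in>verts G. \<bar>b' v\<bar>) < (\<Sum>v\<in>verts G. \<bar>b v\<bar>)"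
        using s t(2) st by (intro sum_strict_mono_ex1) (auto simp: b'_def)
      then show "nat (\<Sum>v\<in>verts G. \<bar>b' v\<bar>) < nat (\<Sum>v\<in>verts G. \<bar>b v\<bar>)"
        by (subst nat_less_eq_zless) (auto intro: sum_nonneg)
      show "sum b' (verts G) = 0"
        using sum_b'[of "verts G"] s(1) tv less.prems(1) by simp
      show "sum b' X \<le> 0" if X: "X \<subseteq> verts G" "leaving G X = {}" for X
      proof -
        have "sum b X \<le> 0" using less.prems(2) X by blast
        moreover have "sum b X \<noteq> 0" if "t \<in> X" "s \<notin> X"
          using t(3) that X by (auto simp: Y_def \<T>_def)
        ultimately show ?thesis by (auto simp: sum_b'[OF X(1)])
      qed
    qed
    then obtain z where z: "\<And>v. v \<in> verts G \<Longrightarrow> net_outflow G z v = b' v" by blast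
    obtain p where p: "awalk s p t"
      using t(1) by (auto simp: R_def reachable_awalk)
    show ?thesis
      by (intro exI[of _ "\<lambda>e. z e + count_list p e"])
        (auto simp: net_outflow_add z net_outflow_awalk[OF p] b'_def)
  qed
qed


section \<open>Duality for transshipments of minimum cost\<close>

text \<open>
  Strong duality for integer data. The supremum over feasible potentials is attained because the
  values are integers bounded by \<open>B\<close>; since all slacks are integers as well, an improvement of an
  optimal potential by 1 on a set that no tight arc leaves would be feasible.
\<close>

lemma (in fin_digraph) transshipment_duality:
  fixes b :: "'a \<Rightarrow> int" and d :: "'b \<Rightarrow> int"
  assumes feasible: "\<And>e. e \<in> arcs G \<Longrightarrow> \<sigma> (tail G e) - \<sigma> (head G e) \<le> d e"
    and bounded: "\<And>\<rho>. (\<And>e. e \<in> arcs G \<Longrightarrow> \<rho> (tail G e) - \<rho> (head G e) \<le> d e)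
        \<Longrightarrow> (\<Sum>v\<in>verts G. b v * \<rho> v) \<le> B"
  shows "\<exists>\<rho> z. (\<forall>e\<in>arcs G. \<rho> (tail G e) - \<rho> (head G e) \<le> d e) \<and>
    (\<forall>v\<in>verts G. net_outflow G z v = b v) \<and>
    (\<Sum>v\<in>verts G. b v * \<rho> v) = (\<Sum>e\<in>arcs G. d e * int (z e))"
proof -
  define feas where "feas \<rho> \<longleftrightarrow> (\<forall>e\<in>arcs G. \<rho> (tail G e) - \<rho> (head G e) \<le> d e)" for \<rho>
  define val where "val \<rho> = (\<Sum>v\<in>verts G. b v * \<rho> v)" for \<rho>
  have "feas \<sigma>" using feasible by (simp add: feas_def)
  then obtain \<rho> where \<rho>: "feas \<rho>" and least: "\<And>\<tau>. feas \<tau> \<Longrightarrow> nat (B - val \<rho>) \<le> nat (B - val \<tau>)"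
    using arg_min_natI[of feas \<sigma> "\<lambda>\<rho>. nat (B - val \<rho>)"]
      arg_min_nat_le[of feas _ "\<lambda>\<rho>. nat (B - val \<rho>)"] by blast
  have optimal: "val \<tau> \<le> val \<rho>" if "feas \<tau>" for \<tau>
  proof -
    have "val \<tau> \<le> B" using bounded[of \<tau>] that by (simp add: feas_def val_def)
    with least[OF that] show ?thesis by linarith
  qed
  \<comment> \<open>the spanning subgraph of the tight arcs\<close>
  define T where "T = G\<lparr>arcs := {e \<in> arcs G. \<rho> (tail G e) - \<rho> (head G e) = d e}\<rparr>"
  interpret T: fin_digraph T
    by unfold_locales (auto simp: T_def)
  have val_shift: "val (\<lambda>v. \<rho> v + c * of_bool (v \<in> X)) = val \<rho> + c * sum b X"
    if "X \<subseteq> verts G" for X c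
  proof -
    have "(\<Sum>v\<in>verts G. c * (b v * of_bool (v \<in> X))) = (\<Sum>v\<in>X. c * b v)"
      using that by (intro sum.mono_neutral_cong_right) auto
    then show ?thesis
      by (simp add: val_def distrib_left sum.distrib sum_distrib_left mult.left_commute)
  qed
  have cut: "sum b X \<le> 0" if X: "X \<subseteq> verts T" "leaving T X = {}" for X
  proof -
    have "feas (\<lambda>v. \<rho> v + 1 * of_bool (v \<in> X))"
      unfolding feas_def
    proof
      fix e assume e: "e \<in> arcs G"
      have "\<rho> (tail G e) - \<rho> (head G e) \<le> d e"
        using \<rho> e by (simp add: feas_def)
      moreover have "\<rho> (tail G e) - \<rho> (head G e) \<noteq> d e" if "tail G e \<in> X" "head G e \<notin> X"
        using X(2) e that by (auto simp: leaving_def T_def)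
      ultimately show "\<rho> (tail G e) + 1 * of_bool (tail G e \<in> X)
          - (\<rho> (head G e) + 1 * of_bool (head G e \<in> X)) \<le> d e"
        by (auto simp: of_bool_def)
    qed
    with optimal[OF this] show ?thesis
      using val_shift[of X 1] X(1) by (simp add: T_def)
  qed
  have "sum b (verts T) = 0"
  proof (rule antisym)
    show "sum b (verts T) \<le> 0"
      by (rule cut) (auto simp: leaving_def)
    \<comment> \<open>a constant shift changes no potential difference\<close>
    have "feas (\<lambda>v. \<rho> v + (-1) * of_bool (v \<in> verts G))"
      using \<rho> by (simp add: feas_def)
    from optimal[OF this] show "0 \<le> sum b (verts T)"
      using val_shift[of "verts G" "-1"] by (simp add: T_def)
  qed
  from T.transshipment[OF this cut]
  obtain z where z: "\<And>v. v \<in> verts T \<Longrightarrow> net_outflow T z v = b v" by blast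
  define z' where "z' e = (if e \<in> arcs T then z e else 0)" for e
  have "net_outflow G z' v = b v" if "v \<in> verts G" for v
    unfolding z'_def using that z[of v]
    by (subst net_outflow_restrict_arcs) (auto simp: T_def fin_digraph_axioms)
  moreover from this have "val \<rho> = (\<Sum>e\<in>arcs G. d e * int (z' e))"
    using sum_net_outflow_times[of z' \<rho>]
    by (auto simp: val_def z'_def T_def intro!: sum.cong)
  ultimately show ?thesis
    using \<rho> by (intro exI[of _ \<rho>] exI[of _ z']) (simp add: feas_def val_def)
qed

section \<open>Circulations covering weighted nodes\<close>

text \<open>
  Every node \<open>v\<close> is split into an exit copy \<open>(v, True)\<close>, where the original arcs leave, and an
  entry copy \<open>(v, False)\<close>, where they arrive. The arcs \<open>Inr (v, True)\<close> and \<open>Inr (v, False)\<close> join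
  the two copies in either direction; bounding the potential differences along them lets a potential
  on the split digraph encode a node set as well as a potential of the original digraph.
\<close>

fun split_arc_tail :: "('a, 'b) pre_digraph \<Rightarrow> 'b + 'a \<times> bool \<Rightarrow> 'a \<times> bool" where
  "split_arc_tail G (Inl e) = (tail G e, True)"
| "split_arc_tail G (Inr (v, s)) = (v, s)"

fun split_arc_head :: "('a, 'b) pre_digraph \<Rightarrow> 'b + 'a \<times> bool \<Rightarrow> 'a \<times> bool" where
  "split_arc_head G (Inl e) = (head G e, False)"
| "split_arc_head G (Inr (v, s)) = (v, \<not> s)"

definition split_nodes :: "('a, 'b) pre_digraph \<Rightarrow> ('a \<times> bool, 'b + 'a \<times> bool) pre_digraph" where
  "split_nodes G = \<lparr> verts = verts G \<times> UNIV, arcs = arcs G <+> verts G \<times> UNIV,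
     tail = split_arc_tail G, head = split_arc_head G \<rparr>"

text \<open>
  In the split digraph give the exit copy of \<open>v\<close> supply \<open>w v\<close> and the entry copy demand \<open>w v\<close>;
  the arc from exit to entry costs 1, its reverse 0. A feasible potential \<open>\<rho>\<close> then rises by 0 or 1
  from entry to exit, and \<open>S\<close> is the set of nodes where it rises by 1. On the flow side, the
  \<open>w v\<close> units travel from exit to entry either around \<open>G\<close> or directly at cost 1 each, and the
  direct units are at least the part of \<open>w v\<close> that is not covered by the circulation.
\<close>

lemma (in fin_digraph) covering_circulation_duality:
  fixes c w :: "_ \<Rightarrow> nat"
  shows "\<exists>S \<pi> z. S \<subseteq> verts G \<and>
    (\<forall>e\<in>arcs G. \<pi> (tail G e) + of_bool (tail G e \<in> S) \<le> \<pi> (head G e) + int (c e)) \<and>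
    (\<forall>v\<in>verts G. net_outflow G z v = 0) \<and>
    (\<Sum>e\<in>arcs G. int (c e) * int (z e))
           + (\<Sum>v\<in>verts G. max (int (w v) - (\<Sum>e\<in>out_arcs G v. int (z e))) 0)
         \<le> (\<Sum>v\<in>S. int (w v))"
proof -
  interpret H: fin_digraph "split_nodes G"
    by unfold_locales (auto simp: split_nodes_def)
  define d :: "'b + 'a \<times> bool \<Rightarrow> int"
    where "d = case_sum (\<lambda>e. int (c e)) (\<lambda>(v, s). of_bool s)"
  define b :: "'a \<times> bool \<Rightarrow> int"
    where "b = (\<lambda>(v, s). if s then int (w v) else - int (w v))"
  have sum_verts: "(\<Sum>n\<in>verts (split_nodes G). f n) = (\<Sum>v\<in>verts G. f (v, True) + f (v, False))"
    for f :: "'a \<times> bool \<Rightarrow> int"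
  proof -
    have "(\<Sum>n\<in>verts (split_nodes G). f n) = (\<Sum>v\<in>verts G. \<Sum>s\<in>UNIV. f (v, s))"
      by (simp add: split_nodes_def sum.cartesian_product)
    then show ?thesis by (simp add: UNIV_bool add.commute)
  qed
  have sum_arcs: "(\<Sum>a\<in>arcs (split_nodes G). f a)
      = (\<Sum>e\<in>arcs G. f (Inl e)) + (\<Sum>v\<in>verts G. f (Inr (v, True)) + f (Inr (v, False)))"
    for f :: "'b + 'a \<times> bool \<Rightarrow> int"
  proof -
    have "(\<Sum>a\<in>arcs (split_nodes G). f a)
        = (\<Sum>e\<in>arcs G. f (Inl e)) + (\<Sum>n\<in>verts (split_nodes G). f (Inr n))"
      by (simp add: split_nodes_def sum.Plus)
    then show ?thesis by (simp add: sum_verts)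
  qed
  have node_bounds: "v \<in> verts G \<Longrightarrow> \<rho> (v, True) - \<rho> (v, False) \<le> 1"
       "v \<in> verts G \<Longrightarrow> \<rho> (v, False) \<le> \<rho> (v, True)"
    if "\<And>a. a \<in> arcs (split_nodes G) \<Longrightarrow>
        \<rho> (tail (split_nodes G) a) - \<rho> (head (split_nodes G) a) \<le> d a"
    for \<rho> v
    using that[of "Inr (v, True)"] that[of "Inr (v, False)"]
    by (auto simp: split_nodes_def d_def)
  have value_eq: "(\<Sum>n\<in>verts (split_nodes G). b n * \<rho> n)
      = (\<Sum>v\<in>verts G. int (w v) * (\<rho> (v, True) - \<rho> (v, False)))" for \<rho>
    by (simp add: sum_verts b_def right_diff_distrib)
  have value_le: "(\<Sum>n\<in>verts (split_nodes G). b n * \<rho> n) \<le> (\<Sum>v\<in>verts G. int (w v))"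
    if "\<And>a. a \<in> arcs (split_nodes G) \<Longrightarrow>
        \<rho> (tail (split_nodes G) a) - \<rho> (head (split_nodes G) a) \<le> d a" for \<rho>
    unfolding value_eq using node_bounds(1)[OF that]
    by (intro sum_mono) (simp add: mult_left_le)
  have d_nonneg: "0 - 0 \<le> d a" for a
    by (auto simp: d_def split: sum.splits)
  obtain \<rho> \<zeta> where
    feas: "\<And>a. a \<in> arcs (split_nodes G) \<Longrightarrow>
        \<rho> (tail (split_nodes G) a) - \<rho> (head (split_nodes G) a) \<le> d a"
    and flow: "\<And>n. n \<in> verts (split_nodes G) \<Longrightarrow> net_outflow (split_nodes G) \<zeta> n = b n"
    and dual: "(\<Sum>n\<in>verts (split_nodes G). b n * \<rho> n)
        = (\<Sum>a\<in>arcs (split_nodes G). d a * int (\<zeta> a))"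
    using H.transshipment_duality[of "\<lambda>_. 0" d b, OF d_nonneg value_le] by blast
  define z where "z e = \<zeta> (Inl e)" for e
  define \<pi> where "\<pi> v = \<rho> (v, False)" for v
  define S where "S = {v \<in> verts G. \<rho> (v, True) - \<rho> (v, False) = 1}"
  have gain: "\<rho> (v, True) - \<rho> (v, False) = of_bool (v \<in> S)" if "v \<in> verts G" for v
    using node_bounds[OF feas that] that by (auto simp: S_def)
  have arcs_at: "out_arcs (split_nodes G) (v, True) = insert (Inr (v, True)) (Inl ` out_arcs G v)"
      "in_arcs (split_nodes G) (v, True) = {Inr (v, False)}"
      "out_arcs (split_nodes G) (v, False) = {Inr (v, False)}"
      "in_arcs (split_nodes G) (v, False) = insert (Inr (v, True)) (Inl ` in_arcs G v)"
    if "v \<in> verts G" for v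
    using that by (auto simp: split_nodes_def in_arcs_def out_arcs_def)
  have split_verts: "verts (split_nodes G) = verts G \<times> UNIV"
    by (simp add: split_nodes_def)
  have fin: "finite (out_arcs G v)" "finite (in_arcs G v)" for v
    by (auto simp: in_arcs_def out_arcs_def)
  have outflow: "(\<Sum>e\<in>out_arcs G v. int (z e)) + int (\<zeta> (Inr (v, True)))
      = int (w v) + int (\<zeta> (Inr (v, False)))" if "v \<in> verts G" for v
    using flow[of "(v, True)"] that fin
    by (simp add: split_verts net_outflow_def arcs_at b_def z_def sum.reindex image_iff)
  have inflow: "(\<Sum>e\<in>in_arcs G v. int (z e)) + int (\<zeta> (Inr (v, True)))
      = int (w v) + int (\<zeta> (Inr (v, False)))" if "v \<in> verts G" for v
    using flow[of "(v, False)"] that fin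
    by (simp add: split_verts net_outflow_def arcs_at b_def z_def sum.reindex image_iff)
  have S: "S \<subseteq> verts G" by (auto simp: S_def)
  have slack: "\<pi> (tail G e) + of_bool (tail G e \<in> S) \<le> \<pi> (head G e) + int (c e)"
    if "e \<in> arcs G" for e
    using feas[of "Inl e"] gain[of "tail G e"] that
    by (simp add: \<pi>_def split_nodes_def d_def InlI algebra_simps)
  have circ: "net_outflow G z v = 0" if "v \<in> verts G" for v
    using inflow[OF that] outflow[OF that] by (simp add: net_outflow_def)
  have "(\<Sum>v\<in>S. int (w v)) = (\<Sum>v\<in>verts G. int (w v) * (\<rho> (v, True) - \<rho> (v, False)))"
    using S by (intro sum.mono_neutral_cong_left) (auto simp: gain)
  also have "\<dots> = (\<Sum>e\<in>arcs G. int (c e) * int (z e)) + (\<Sum>v\<in>verts G. int (\<zeta> (Inr (v, True))))"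
    using dual unfolding value_eq sum_arcs by (simp add: d_def z_def)
  also have "\<dots> \<ge> (\<Sum>e\<in>arcs G. int (c e) * int (z e))
      + (\<Sum>v\<in>verts G. max (int (w v) - (\<Sum>e\<in>out_arcs G v. int (z e))) 0)"
    using outflow by (intro add_left_mono sum_mono) (smt (verit) of_nat_0_le_iff)
  finally show ?thesis
    using S slack circ by blast
qed

section \<open>Di-circuits\<close>

lemma (in wf_digraph) dicircuit_through_arc:
  assumes e: "e \<in> arcs G" and "head G e \<rightarrow>\<^sup>* tail G e"
  obtains K where "K \<in> dicircuits G" "e \<in> K"
proof -
  obtain p where p: "apath (head G e) p (tail G e)"
    using assms(2) reachable_apath by blast
  then have "cycle (e # p)"
    using e by (auto simp: cycle_def apath_def awalk_Cons_iff intro!: exI[of _ "tail G e"])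
  then show ?thesis
    by (intro that[of "set (e # p)"]) (unfold dicircuits_def, blast, simp)
qed

text \<open>
  The node sequence of the closed walk, read off from the tails, is a rotation of the one read off
  from the heads. So each node occurs once as a tail and once as a head, which is why potential
  differences sum to 0 over a di-circuit.
\<close>

lemma (in wf_digraph) dicircuit_structure:
  assumes "K \<in> dicircuits G"
  shows "finite K" "K \<subseteq> arcs G" "inj_on (tail G) K" "inj_on (head G) K"
    "tail G ` K = nodes_of G K" "head G ` K = nodes_of G K"
proof -
  obtain p u where p: "awalk u p u" "distinct (tl (awalk_verts u p))" "p \<noteq> []"
    and K: "K = set p"
    using assms by (auto simp: dicircuits_def cycle_def)
  have "cas u p u" using p(1) by (simp add: awalk_def)
  then have "awalk_verts u p = u # map (head G) p"
    using awalk_verts_conv'[of u p u] p(3) by (simp add: cas_simp)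
  moreover have "awalk_verts u p = map (tail G) p @ [u]"
    using awlast_of_awalk[OF p(1)] p(3) by (simp add: awalk_verts_conv)
  \<comment> \<open>the node sequence of the closed walk, read off from the tails and from the heads\<close>
  ultimately have shift: "map (tail G) p @ [u] = u # map (head G) p" by simp
  have dist: "distinct (map (head G) p)"
    using p(2) \<open>awalk_verts u p = u # map (head G) p\<close> by simp
  have "mset (map (tail G) p) = mset (map (head G) p)"
    using arg_cong[OF shift, of mset] by simp
  then have eq: "set (map (tail G) p) = set (map (head G) p)"
    and dist': "distinct (map (tail G) p)"
    using dist by (metis set_mset_mset, metis mset_eq_imp_distinct_iff)
  show "finite K" "K \<subseteq> arcs G" "inj_on (tail G) K" "inj_on (head G) K"
    "tail G ` K = nodes_of G K" "head G ` K = nodes_of G K"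
    using K p(1) dist dist' eq by (auto simp: awalk_def distinct_map nodes_of_def)
qed

lemma (in wf_digraph) dicircuit_sums:
  assumes "K \<in> dicircuits G"
  shows "(\<Sum>e\<in>K. f (tail G e)) = sum f (nodes_of G K)"
    and "(\<Sum>e\<in>K. f (head G e)) = sum f (nodes_of G K)"
  using dicircuit_structure[OF assms] sum.reindex[of "tail G" K f] sum.reindex[of "head G" K f]
  by (auto simp: o_def)

lemma (in fin_digraph) finite_dicircuits: "finite (dicircuits G)"
  by (rule finite_subset[of _ "Pow (arcs G)"]) (auto dest: dicircuit_structure(2))

text \<open>
  The set of nodes reachable from the head of \<open>a\<close> along arcs of positive flow is left by no flow,
  hence entered by none; so it contains the tail of \<open>a\<close>, and the walk back closes a di-circuit.
\<close>

lemma (in fin_digraph) circulation_imp_dicircuit: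
  assumes circ: "\<And>v. v \<in> verts G \<Longrightarrow> net_outflow G z v = 0"
    and a: "a \<in> arcs G" "z a > 0"
  obtains K where "K \<in> dicircuits G" "a \<in> K" "\<And>e. e \<in> K \<Longrightarrow> z e > 0"
proof -
  define H where "H = G\<lparr>arcs := {e \<in> arcs G. z e > 0}\<rparr>"
  interpret H: fin_digraph H
    by unfold_locales (auto simp: H_def)
  define X where "X = {x. head H a \<rightarrow>\<^sup>*\<^bsub>H\<^esub> x}"
  have aH: "a \<in> arcs H" using a by (simp add: H_def)
  have "z e = 0" if "e \<in> leaving G X" for e
  proof (rule ccontr)
    assume "z e \<noteq> 0"
    with that have "e \<in> arcs H" by (simp add: H_def leaving_def)
    moreover have "tail H e \<in> X" "head H e \<notin> X" using that by (auto simp: H_def leaving_def)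
    ultimately show False
      unfolding X_def mem_Collect_eq
      by (metis H.in_arcs_imp_in_arcs_ends H.reachable_adjI H.reachable_trans)
  qed
  from circulation_cut[where X = X and e = a, OF circ this] a(2) have "a \<notin> entering G X" by auto
  moreover have "head G a \<in> X"
    using H.reachable_refl[OF H.head_in_verts[OF aH]] by (simp add: X_def H_def)
  ultimately have "head H a \<rightarrow>\<^sup>*\<^bsub>H\<^esub> tail H a"
    using a(1) by (auto simp: entering_def X_def H_def)
  from H.dicircuit_through_arc[OF aH this] obtain K where K: "K \<in> dicircuits H" "a \<in> K" .
  have "subgraph H G"
    unfolding subgraph_def compatible_def
    using wf_digraph_axioms H.wf_digraph_axioms by (auto simp: H_def)
  then have "K \<in> dicircuits G"
    using K(1) by (auto simp: dicircuits_def dest: subgraph_cycle)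
  then show ?thesis
    using that K H.dicircuit_structure(2)[OF K(1)] by (auto simp: H_def)
qed

lemma (in fin_digraph) net_outflow_dicircuit:
  assumes "K \<in> dicircuits G"
  shows "net_outflow G (\<lambda>e. of_bool (e \<in> K)) v = 0"
proof -
  note K = dicircuit_structure[OF assms]
  have fin: "finite (out_arcs G v)" "finite (in_arcs G v)"
    by (auto simp: in_arcs_def out_arcs_def)
  have "(\<Sum>e\<in>out_arcs G v. int (of_bool (e \<in> K))) = (\<Sum>e\<in>K. of_bool (tail G e = v))"
    using K(1,2) fin by (intro sum.mono_neutral_cong) (auto simp: out_arcs_def)
  moreover have "(\<Sum>e\<in>in_arcs G v. int (of_bool (e \<in> K))) = (\<Sum>e\<in>K. of_bool (head G e = v))"
    using K(1,2) fin by (intro sum.mono_neutral_cong) (auto simp: in_arcs_def)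
  ultimately show ?thesis
    using dicircuit_sums[OF assms, of "\<lambda>x. of_bool (x = v) :: int"]
    by (simp add: net_outflow_def)
qed

text \<open>
  Subtracting one unit along a di-circuit of positive flow leaves a smaller circulation, so the
  total flow serves for an induction.
\<close>

lemma (in fin_digraph) circulation_decomposition:
  assumes "\<And>v. v \<in> verts G \<Longrightarrow> net_outflow G z v = 0"
  shows "\<exists>y. \<forall>e\<in>arcs G. z e = (\<Sum>K | K \<in> dicircuits G \<and> e \<in> K. y K)"
  using assms
proof (induction "sum z (arcs G)" arbitrary: z rule: less_induct)
  case less
  show ?case
  proof (cases "\<exists>a\<in>arcs G. z a > 0")
    case False
    then show ?thesis by (intro exI[of _ "\<lambda>_. 0"]) auto
  next
    case True
    then obtain a where a: "a \<in> arcs G" "z a > 0" by blast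
    obtain C where C: "C \<in> dicircuits G" "a \<in> C" "\<And>e. e \<in> C \<Longrightarrow> z e > 0"
      using circulation_imp_dicircuit[OF less.prems a] by blast
    define z' where "z' e = z e - of_bool (e \<in> C)" for e
    have z: "z = (\<lambda>e. of_bool (e \<in> C) + z' e)"
      using C(3) by (force simp: z'_def)
    have "sum z' (arcs G) < sum z (arcs G)"
      using a C(2) by (intro sum_strict_mono_ex1) (auto simp: z'_def intro!: bexI[of _ a])
    moreover have "net_outflow G z' v = 0" if "v \<in> verts G" for v
      using less.prems[OF that] net_outflow_add[of "\<lambda>e. of_bool (e \<in> C)" z' v]
      by (simp add: net_outflow_dicircuit[OF C(1)] z[symmetric])
    ultimately obtain y where y: "\<And>e. e \<in> arcs G \<Longrightarrow> z' e = (\<Sum>K | K \<in> dicircuits G \<and> e \<in> K. y K)"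
      using less.hyps[of z'] by blast
    have "z e = (\<Sum>K | K \<in> dicircuits G \<and> e \<in> K. y K + of_bool (K = C))" if "e \<in> arcs G" for e
    proof -
      have "(\<Sum>K | K \<in> dicircuits G \<and> e \<in> K. of_bool (K = C)) = (of_bool (e \<in> C) :: nat)"
        using C(1) finite_dicircuits by (auto simp: of_bool_def sum.delta)
      moreover have "z e = of_bool (e \<in> C) + z' e" by (rule fun_cong[OF z])
      ultimately show ?thesis using y[OF that] by (simp add: sum.distrib)
    qed
    then show ?thesis by (intro exI[of _ "\<lambda>K. y K + of_bool (K = C)"]) auto
  qed
qed

section \<open>Potentials of stable sets\<close>

text \<open>
  The potential counts, for each node, the sets \<open>Z\<close> defining the dicuts that contain it. Along an
  edge of the digraph with \<open>F\<close> reversed it grows by 1 if the edge is in some dicut, since the dicuts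
  are disjoint, and by 0 otherwise. Summing the slack over \<open>K\<close> leaves only the contribution of
  \<open>F\<close>.
\<close>

lemma (in fin_digraph) F_stable_dicircuit_bound:
  assumes "F_stable G F S" and K: "K \<in> dicircuits G"
  shows "card (S \<inter> nodes_of G K) \<le> card (F \<inter> K)"
proof -
  let ?D = "reverse_edges G F"
  obtain \<C> where dicuts: "\<And>C. C \<in> \<C> \<Longrightarrow> dicut ?D C" and disj: "disjoint \<C>"
    and sink: "sink_set (reverse_edges ?D (\<Union>\<C>)) S"
    using assms(1) by (auto simp: F_stable_def sink_stable_def)
  have "\<forall>C\<in>\<C>. \<exists>Z. leaving ?D Z = {} \<and> C = entering ?D Z"
    using dicuts by (auto simp: dicut_def)
  then obtain Z where Z: "\<And>C. C \<in> \<C> \<Longrightarrow> leaving ?D (Z C) = {} \<and> C = entering ?D (Z C)"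
    by metis
  have "\<C> \<subseteq> Pow (arcs G)"
    using Z by (auto simp: entering_def reverse_edges_def)
  then have fin: "finite \<C>" by (rule finite_subset) simp
  define \<pi> :: "'a \<Rightarrow> int" where "\<pi> v = (\<Sum>C\<in>\<C>. of_bool (v \<in> Z C))" for v
  have step: "\<pi> (head ?D e) - \<pi> (tail ?D e) = of_bool (e \<in> \<Union>\<C>)" if "e \<in> arcs G" for e
  proof -
    have e: "e \<in> arcs ?D" using that by (simp add: reverse_edges_def)
    have "\<pi> (head ?D e) - \<pi> (tail ?D e) = (\<Sum>C\<in>\<C>. of_bool (e \<in> C))"
      unfolding \<pi>_def sum_subtractf[symmetric]
    proof (rule sum.cong)
      fix C assume "C \<in> \<C>"
      then have "leaving ?D (Z C) = {}" and C: "e \<in> C \<longleftrightarrow> e \<in> entering ?D (Z C)"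
        using Z by auto
      then have "tail ?D e \<in> Z C \<Longrightarrow> head ?D e \<in> Z C"
        using e by (auto simp: leaving_def)
      then show "of_bool (head ?D e \<in> Z C) - of_bool (tail ?D e \<in> Z C) = (of_bool (e \<in> C) :: int)"
        using e C by (auto simp: entering_def)
    qed simp
    also have "\<dots> = of_bool (e \<in> \<Union>\<C>)"
    proof (cases "e \<in> \<Union>\<C>")
      case True
      then obtain C where C: "C \<in> \<C>" "e \<in> C" by blast
      have "(\<Sum>B\<in>\<C>. of_bool (e \<in> B)) = (\<Sum>B\<in>\<C>. if B = C then 1 else 0 :: int)"
      proof (rule sum.cong)
        fix B assume "B \<in> \<C>"
        then have "e \<in> B \<longleftrightarrow> B = C" using C disj by (auto simp: disjoint_def)
        then show "of_bool (e \<in> B) = (if B = C then 1 else 0 :: int)" by simp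
      qed simp
      then show ?thesis using True C fin by simp
    qed auto
    finally show ?thesis .
  qed
  have slack: "of_bool (tail G e \<in> S) \<le> \<pi> (head G e) - \<pi> (tail G e) + of_bool (e \<in> F)"
    if "e \<in> arcs G" for e
  proof -
    have "tail (reverse_edges ?D (\<Union>\<C>)) e \<notin> S"
      using sink that by (fastforce simp: sink_set_def sink_node_def out_arcs_def reverse_edges_def)
    then show ?thesis
      using step[OF that] by (auto simp: reverse_edges_def split: if_splits)
  qed
  note KK = dicircuit_structure[OF K]
  have "int (card (S \<inter> nodes_of G K)) = (\<Sum>v\<in>nodes_of G K. of_bool (v \<in> S))"
    using KK(1) by (simp add: nodes_of_def Int_def conj_commute)
  also have "\<dots> = (\<Sum>e\<in>K. of_bool (tail G e \<in> S))"
    by (rule dicircuit_sums(1)[OF K, symmetric])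
  also have "\<dots> \<le> (\<Sum>e\<in>K. \<pi> (head G e) - \<pi> (tail G e) + of_bool (e \<in> F))"
    using KK(2) by (intro sum_mono slack) auto
  also have "\<dots> = (\<Sum>e\<in>K. of_bool (e \<in> F))"
    by (simp add: sum.distrib sum_subtractf dicircuit_sums[OF K])
  also have "\<dots> = int (card (F \<inter> K))"
    using KK(1) by (simp add: Int_def conj_commute)
  finally show ?thesis by simp
qed

text \<open>
  Every edge \<open>e\<close> lies on a di-circuit with exactly one edge in \<open>F\<close>, on which the nonnegative
  integers \<open>t\<close> sum to 1. Hence \<open>t e \<le> 1\<close>, and if \<open>e\<close> enters a node of \<open>S\<close>, the next edge of the
  di-circuit uses up the whole sum, so \<open>t e = 0\<close>. The required dicuts are the boundaries of the level
  sets of \<open>\<pi>\<close>.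
\<close>

lemma (in loopfree_digraph) F_stable_of_potential:
  fixes \<pi> :: "'a \<Rightarrow> int"
  assumes strong: "strongly_connected G" and flat: "flat G F" and S: "S \<subseteq> verts G"
    and slack: "\<And>e. e \<in> arcs G \<Longrightarrow>
      \<pi> (tail G e) + of_bool (tail G e \<in> S) \<le> \<pi> (head G e) + of_bool (e \<in> F)"
  shows "F_stable G F S"
proof -
  define t where "t e = \<pi> (head G e) - \<pi> (tail G e) + of_bool (e \<in> F)" for e
  have t_nonneg: "t e \<ge> 0" and t_leave: "tail G e \<in> S \<Longrightarrow> t e \<ge> 1" if "e \<in> arcs G" for e
    using slack[OF that] by (auto simp: t_def of_bool_def split: if_splits)
  have t_enter: "t e \<le> of_bool (head G e \<notin> S)" if e: "e \<in> arcs G" for e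
  proof -
    have "head G e \<rightarrow>\<^sup>* tail G e"
      using strong e by (auto simp: strongly_connected_def)
    then have "cyclic_edge G e"
      using dicircuit_through_arc[OF e] unfolding cyclic_edge_def by metis
    then obtain K where K: "K \<in> dicircuits G" "e \<in> K" "card (F \<inter> K) = 1"
      using flat e by (auto simp: flat_def)
    note KK = dicircuit_structure[OF K(1)]
    have "(\<Sum>a\<in>K. t a) = (\<Sum>a\<in>K. of_bool (a \<in> F))"
      unfolding t_def by (simp add: sum.distrib sum_subtractf dicircuit_sums[OF K(1)])
    also have "\<dots> = int (card (F \<inter> K))"
      using KK(1) by (simp add: Int_def conj_commute)
    finally have one: "(\<Sum>a\<in>K. t a) = 1" using K(3) by simp
    have "head G e \<in> tail G ` K"
      using KK(5,6) K(2) by blast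
    then obtain a where a: "a \<in> K" "tail G a = head G e" by auto
    \<comment> \<open>the successor of \<open>e\<close> on \<open>K\<close> could be \<open>e\<close> itself only if \<open>e\<close> were a loop\<close>
    have "a \<noteq> e" using a(2) no_loops[OF e] by auto
    then have "t e + t a = sum t {e, a}" by simp
    also have "\<dots> \<le> sum t K"
      using K(2) a(1) KK(1,2) t_nonneg by (intro sum_mono2) auto
    finally have "t e + t a \<le> 1" using one by simp
    moreover have "t a \<ge> of_bool (head G e \<in> S)"
      using t_leave[of a] t_nonneg[of a] a KK(2) by auto
    ultimately show ?thesis by auto
  qed
  let ?D = "reverse_edges G F"
  define Z where "Z j = {v \<in> verts G. j \<le> \<pi> v}" for j
  define \<C> where "\<C> = range (\<lambda>j. entering ?D (Z j))"
  have D_step: "\<pi> (head ?D e) - \<pi> (tail ?D e) = (if e \<in> F then 1 - t e else t e)" for e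
    by (auto simp: reverse_edges_def t_def)
  have t_01: "t e = 0 \<or> t e = 1" if "e \<in> arcs G" for e
    using t_nonneg[OF that] t_enter[OF that] by (auto simp: of_bool_def split: if_splits)
  \<comment> \<open>an edge enters exactly one level set if \<open>\<pi>\<close> grows along it, and none otherwise\<close>
  have enter: "e \<in> entering ?D (Z j) \<longleftrightarrow>
      e \<in> arcs G \<and> t e = of_bool (e \<notin> F) \<and> j = \<pi> (head ?D e)" for e j
  proof (cases "e \<in> arcs G")
    case True
    then have "tail ?D e \<in> verts G" "head ?D e \<in> verts G" "e \<in> arcs ?D"
      by (auto simp: reverse_edges_def)
    then have "e \<in> entering ?D (Z j) \<longleftrightarrow> \<pi> (tail ?D e) < j \<and> j \<le> \<pi> (head ?D e)"
      by (auto simp: entering_def Z_def)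
    then show ?thesis
      using D_step[of e] t_01[OF True] True by (auto split: if_splits)
  qed (auto simp: entering_def reverse_edges_def)
  have Un: "\<Union>\<C> = {e \<in> arcs G. t e = of_bool (e \<notin> F)}"
    by (auto simp: \<C>_def enter)
  have "dicut ?D C" if "C \<in> \<C>" for C
  proof -
    obtain j where C: "C = entering ?D (Z j)" using \<open>C \<in> \<C>\<close> by (auto simp: \<C>_def)
    have "e \<notin> leaving ?D (Z j)" for e
    proof
      assume e: "e \<in> leaving ?D (Z j)"
      then have eG: "e \<in> arcs G" by (simp add: leaving_def reverse_edges_def)
      then have "head ?D e \<in> verts G" by (auto simp: reverse_edges_def)
      then have "\<pi> (head ?D e) < \<pi> (tail ?D e)"
        using e by (auto simp: leaving_def Z_def)
      then show False using D_step[of e] t_01[OF eG] by (auto split: if_splits)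
    qed
    moreover have "Z j \<subseteq> verts ?D" by (auto simp: Z_def reverse_edges_def)
    ultimately show ?thesis unfolding dicut_def C by blast
  qed
  moreover have "disjoint \<C>"
    by (rule disjointI) (auto simp: \<C>_def enter)
  moreover have "sink_set (reverse_edges ?D (\<Union>\<C>)) S"
    unfolding sink_set_def sink_node_def
  proof (intro ballI conjI)
    fix v assume v: "v \<in> S"
    then show "v \<in> verts (reverse_edges ?D (\<Union>\<C>))"
      using S by (auto simp: reverse_edges_def)
    have "tail (reverse_edges ?D (\<Union>\<C>)) e \<noteq> v" if e: "e \<in> arcs G" for e
    proof
      assume "tail (reverse_edges ?D (\<Union>\<C>)) e = v"
      then have "tail G e \<in> S \<and> t e = 0 \<or> head G e \<in> S \<and> t e = 1"
        using v e t_01[OF e] unfolding Un by (auto simp: reverse_edges_def split: if_splits)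
      then show False using t_leave[OF e] t_enter[OF e] by auto
    qed
    then show "out_arcs (reverse_edges ?D (\<Union>\<C>)) v = {}"
      by (auto simp: out_arcs_def reverse_edges_def)
  qed
  ultimately show ?thesis
    unfolding F_stable_def sink_stable_def by blast
qed

text \<open>
  The residue classes of \<open>\<pi>\<close> modulo \<open>k\<close> split \<open>S\<close>. For the class of \<open>i\<close>, the potential
  \<open>\<lceil>(\<pi> v - i) / k\<rceil>\<close> is a witness: rounding turns the decrease by at most \<open>k\<close> along edges of
  \<open>F\<close> into a decrease by at most 1, and an increase by 1 starting at a multiple of \<open>k\<close> (shifted by
  \<open>i\<close>) lifts the rounded value.
\<close>

lemma (in loopfree_digraph) k_union_of_potential:
  fixes \<pi> :: "'a \<Rightarrow> int"
  assumes strong: "strongly_connected G" and flat: "flat G F" and S: "S \<subseteq> verts G"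
    and k: "k > 0"
    and slack: "\<And>e. e \<in> arcs G \<Longrightarrow>
      \<pi> (tail G e) + of_bool (tail G e \<in> S) \<le> \<pi> (head G e) + int (k * of_bool (e \<in> F))"
  shows "k_union_F_stable G F k S"
proof -
  define P where "P i = {v \<in> S. \<pi> v mod int k = int i}" for i
  have "F_stable G F (P i)" if "i < k" for i
  proof (rule F_stable_of_potential[OF strong flat])
    show "P i \<subseteq> verts G" using S by (auto simp: P_def)
    \<comment> \<open>the ceiling of \<open>(\<pi> v - i) / k\<close>\<close>
    define \<sigma> where "\<sigma> v = (\<pi> v - int i + int k - 1) div int k" for v
    fix e assume e: "e \<in> arcs G"
    have shift: "\<sigma> (head G e) + of_bool (e \<in> F)
        = (\<pi> (head G e) + int (k * of_bool (e \<in> F)) - int i + int k - 1) div int k"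
      using k div_mult_self1[of "int k" "\<pi> (head G e) - int i + int k - 1" "of_bool (e \<in> F)"]
      by (simp add: \<sigma>_def algebra_simps)
    have "\<sigma> (tail G e) + of_bool (tail G e \<in> P i)
        \<le> (\<pi> (tail G e) + of_bool (tail G e \<in> S) - int i + int k - 1) div int k"
    proof (cases "tail G e \<in> P i")
      case True
      define m where "m = \<pi> (tail G e) div int k"
      have m: "\<pi> (tail G e) = m * int k + int i"
        using True div_mult_mod_eq[of "\<pi> (tail G e)" "int k"] by (simp add: P_def m_def)
      have "\<sigma> (tail G e) = m"
        using k unfolding \<sigma>_def m
        by (intro int_div_pos_eq[where r = "int k - 1"]) (auto simp: algebra_simps)
      moreover have "(\<pi> (tail G e) + of_bool (tail G e \<in> S) - int i + int k - 1) div int k = m + 1"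
        using k True unfolding m
        by (intro int_div_pos_eq[where r = 0]) (auto simp: P_def algebra_simps)
      ultimately show ?thesis using True by simp
    next
      case False
      then show ?thesis using k by (auto simp: \<sigma>_def intro!: zdiv_mono1)
    qed
    also have "\<dots> \<le> \<sigma> (head G e) + of_bool (e \<in> F)"
      unfolding shift using slack[OF e] k by (intro zdiv_mono1) auto
    finally show "\<sigma> (tail G e) + of_bool (tail G e \<in> P i) \<le> \<sigma> (head G e) + of_bool (e \<in> F)" .
  qed
  moreover have "disjoint_family_on P {..<k}"
    by (auto simp: disjoint_family_on_def P_def)
  moreover have "S = (\<Union>i<k. P i)"
  proof -
    have "\<exists>i<k. \<pi> v mod int k = int i" for v
      using k by (intro exI[of _ "nat (\<pi> v mod int k)"]) (simp add: nat_less_iff)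
    then show ?thesis by (auto simp: P_def)
  qed
  ultimately show ?thesis unfolding k_union_F_stable_def by blast
qed

lemma (in fin_digraph) k_union_dicircuit_bound:
  assumes "k_union_F_stable G F k S" and K: "K \<in> dicircuits G"
  shows "card (S \<inter> nodes_of G K) \<le> k * card (F \<inter> K)"
proof -
  obtain P where P: "\<And>i. i < k \<Longrightarrow> F_stable G F (P i)" "S = (\<Union>i<k. P i)"
    using assms(1) by (auto simp: k_union_F_stable_def)
  have "S \<inter> nodes_of G K = (\<Union>i\<in>{..<k}. P i \<inter> nodes_of G K)" using P(2) by auto
  then have "card (S \<inter> nodes_of G K) \<le> (\<Sum>i<k. card (P i \<inter> nodes_of G K))"
    using card_UN_le[of "{..<k}" "\<lambda>i. P i \<inter> nodes_of G K"] by simp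
  also have "\<dots> \<le> (\<Sum>i<k. card (F \<inter> K))"
    using P(1) K by (intro sum_mono F_stable_dicircuit_bound) auto
  finally show ?thesis by simp
qed

lemma k_union_F_stable_subset:
  assumes "k_union_F_stable G F k S" "T \<subseteq> S"
  shows "k_union_F_stable G F k T"
proof -
  obtain P where P: "\<And>i. i < k \<Longrightarrow> F_stable G F (P i)" "disjoint_family_on P {..<k}"
      "S = (\<Union>i<k. P i)"
    using assms(1) by (auto simp: k_union_F_stable_def)
  have "F_stable G F (P i \<inter> T)" if "i < k" for i
    using P(1)[OF that] unfolding F_stable_def sink_stable_def sink_set_def by blast
  then show ?thesis
    using P(2,3) assms(2) unfolding k_union_F_stable_def
    by (intro exI[of _ "\<lambda>i. P i \<inter> T"]) (auto simp: disjoint_family_on_def)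
qed

section \<open>The min-max formula\<close>

definition dual_value :: "('a, 'b) pre_digraph \<Rightarrow> 'b set \<Rightarrow> nat \<Rightarrow> ('a \<Rightarrow> nat) \<Rightarrow> ('b set \<Rightarrow> nat) \<Rightarrow> int"
  where "dual_value G F k w y =
    int k * (\<Sum>K\<in>dicircuits G. int (y K) * int (card (F \<inter> K)))
      + (\<Sum>v\<in>verts G. max (int (w v) - (\<Sum>K | K \<in> dicircuits G \<and> v \<in> nodes_of G K. int (y K))) 0)"

text \<open>
  Split the weight of each node of \<open>S\<close> into the part covered by \<open>y\<close> and the rest; the covered
  part is counted di-circuit by di-circuit.
\<close>

lemma (in fin_digraph) k_union_weight_le_dual_value:
  assumes S: "S \<subseteq> verts G" "k_union_F_stable G F k S"
  shows "(\<Sum>v\<in>S. int (w v)) \<le> dual_value G F k w y"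
proof -
  define Y where "Y v = (\<Sum>K | K \<in> dicircuits G \<and> v \<in> nodes_of G K. int (y K))" for v
  have finS: "finite S" using S(1) by (rule finite_subset) simp
  have "(\<Sum>v\<in>S. int (w v)) \<le> (\<Sum>v\<in>S. Y v + max (int (w v) - Y v) 0)"
    by (intro sum_mono) auto
  also have "\<dots> = (\<Sum>v\<in>S. Y v) + (\<Sum>v\<in>S. max (int (w v) - Y v) 0)"
    by (rule sum.distrib)
  also have "\<dots> \<le> (\<Sum>v\<in>S. Y v) + (\<Sum>v\<in>verts G. max (int (w v) - Y v) 0)"
    using S(1) by (intro add_left_mono sum_mono2) auto
  also have "(\<Sum>v\<in>S. Y v)
      = (\<Sum>v\<in>S. \<Sum>K\<in>dicircuits G. int (y K) * of_bool (v \<in> nodes_of G K))"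
    unfolding Y_def using finite_dicircuits
    by (intro sum.cong sum.mono_neutral_cong_left) auto
  also have "\<dots> = (\<Sum>K\<in>dicircuits G. \<Sum>v\<in>S. int (y K) * of_bool (v \<in> nodes_of G K))"
    by (rule sum.swap)
  also have "\<dots> = (\<Sum>K\<in>dicircuits G. int (y K) * int (card (S \<inter> nodes_of G K)))"
    using finS by (simp add: sum_distrib_left[symmetric] Int_def)
  also have "\<dots> \<le> (\<Sum>K\<in>dicircuits G. int (y K) * int (k * card (F \<inter> K)))"
    using k_union_dicircuit_bound[OF S(2)] by (intro sum_mono mult_left_mono) (auto simp del: of_nat_mult)
  also have "\<dots> = int k * (\<Sum>K\<in>dicircuits G. int (y K) * int (card (F \<inter> K)))"
    by (simp add: sum_distrib_left mult.left_commute)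
  finally show ?thesis by (simp add: dual_value_def Y_def)
qed

text \<open>
  The circulation has cost \<open>k\<close> on the edges of \<open>F\<close> and 0 elsewhere; written as a sum of
  di-circuits with multiplicities \<open>y\<close>, its cost and the flow through each node become the two terms
  of the dual value.
\<close>

lemma k_union_weight_attains_dual_value:
  assumes "fin_digraph G" and "loopfree_digraph G" and "strongly_connected G"
    and "flat G F" and "k > 0"
  shows "\<exists>S y. S \<subseteq> verts G \<and> k_union_F_stable G F k S \<and>
    (\<Sum>v\<in>S. int (w v)) = dual_value G F k w y"
proof -
  interpret fin_digraph G by fact
  interpret loopfree_digraph G by fact
  obtain S \<pi> z where S: "S \<subseteq> verts G"
    and slack: "\<And>e. e \<in> arcs G \<Longrightarrow>
      \<pi> (tail G e) + of_bool (tail G e \<in> S) \<le> \<pi> (head G e) + int (k * of_bool (e \<in> F))"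
    and circ: "\<And>v. v \<in> verts G \<Longrightarrow> net_outflow G z v = 0"
    and cost: "(\<Sum>e\<in>arcs G. int (k * of_bool (e \<in> F)) * int (z e))
           + (\<Sum>v\<in>verts G. max (int (w v) - (\<Sum>e\<in>out_arcs G v. int (z e))) 0)
         \<le> (\<Sum>v\<in>S. int (w v))"
    using covering_circulation_duality[of "\<lambda>e. k * of_bool (e \<in> F)" w] by blast
  have kS: "k_union_F_stable G F k S"
    using k_union_of_potential[OF assms(3,4) S assms(5) slack] .
  obtain y where y: "\<And>e. e \<in> arcs G \<Longrightarrow> z e = (\<Sum>K | K \<in> dicircuits G \<and> e \<in> K. y K)"
    using circulation_decomposition[OF circ] by blast
  \<comment> \<open>double counting of pairs of an edge in \<open>A\<close> and a di-circuit through it\<close>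
  have z_sum: "(\<Sum>e\<in>A. int (z e)) = (\<Sum>K\<in>dicircuits G. int (y K) * int (card (A \<inter> K)))"
    if A: "A \<subseteq> arcs G" for A
  proof -
    have finA: "finite A" using A by (rule finite_subset) simp
    have "(\<Sum>e\<in>A. int (z e)) = (\<Sum>e\<in>A. \<Sum>K\<in>dicircuits G. int (y K) * of_bool (e \<in> K))"
    proof (rule sum.cong)
      fix e assume "e \<in> A"
      then have "int (z e) = (\<Sum>K | K \<in> dicircuits G \<and> e \<in> K. int (y K))"
        using y A by (simp add: subset_iff)
      also have "\<dots> = (\<Sum>K\<in>dicircuits G. int (y K) * of_bool (e \<in> K))"
        using finite_dicircuits by (intro sum.mono_neutral_cong_left) auto
      finally show "int (z e) = (\<Sum>K\<in>dicircuits G. int (y K) * of_bool (e \<in> K))" .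
    qed simp
    also have "\<dots> = (\<Sum>K\<in>dicircuits G. \<Sum>e\<in>A. int (y K) * of_bool (e \<in> K))"
      by (rule sum.swap)
    also have "\<dots> = (\<Sum>K\<in>dicircuits G. int (y K) * int (card (A \<inter> K)))"
      using finA by (simp add: sum_distrib_left[symmetric] Int_def)
    finally show ?thesis .
  qed
  have "F \<subseteq> arcs G" using assms(4) by (simp add: flat_def)
  have "(\<Sum>e\<in>arcs G. int (k * of_bool (e \<in> F)) * int (z e)) = int k * (\<Sum>e\<in>F. int (z e))"
    unfolding sum_distrib_left using \<open>F \<subseteq> arcs G\<close>
    by (intro sum.mono_neutral_cong_right) auto
  then have arcs_eq: "(\<Sum>e\<in>arcs G. int (k * of_bool (e \<in> F)) * int (z e))
      = int k * (\<Sum>K\<in>dicircuits G. int (y K) * int (card (F \<inter> K)))"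
    by (simp only: z_sum[OF \<open>F \<subseteq> arcs G\<close>])
  have node_eq: "(\<Sum>e\<in>out_arcs G v. int (z e))
      = (\<Sum>K | K \<in> dicircuits G \<and> v \<in> nodes_of G K. int (y K))" for v
  proof -
    \<comment> \<open>a di-circuit leaves each of its nodes by exactly one edge\<close>
    have "card (out_arcs G v \<inter> K) = of_bool (v \<in> nodes_of G K)" if "K \<in> dicircuits G" for K
    proof -
      note KK = dicircuit_structure[OF that]
      have "out_arcs G v \<inter> K = {e \<in> K. tail G e = v}" using KK(2) by (auto simp: out_arcs_def)
      then have "int (card (out_arcs G v \<inter> K)) = (\<Sum>e\<in>K. of_bool (tail G e = v))"
        using KK(1) by (simp add: Int_def)
      also have "\<dots> = (\<Sum>x\<in>nodes_of G K. of_bool (x = v))"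
        by (rule dicircuit_sums(1)[OF that])
      also have "\<dots> = of_bool (v \<in> nodes_of G K)"
        using KK(1) by (auto simp: nodes_of_def of_bool_def)
      finally show ?thesis by (simp add: of_bool_def split: if_splits)
    qed
    then have "(\<Sum>e\<in>out_arcs G v. int (z e))
        = (\<Sum>K\<in>dicircuits G. int (y K) * of_bool (v \<in> nodes_of G K))"
      by (subst z_sum) (auto simp: out_arcs_def)
    also have "\<dots> = (\<Sum>K | K \<in> dicircuits G \<and> v \<in> nodes_of G K. int (y K))"
      using finite_dicircuits by (intro sum.mono_neutral_cong_right) auto
    finally show ?thesis .
  qed
  have "dual_value G F k w y \<le> (\<Sum>v\<in>S. int (w v))"
    using cost unfolding arcs_eq node_eq dual_value_def .
  with k_union_weight_le_dual_value[OF S kS, of w y] show ?thesis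
    using S kS by (intro exI[of _ S] exI[of _ y]) simp
qed

definition cover_value :: "('a, 'b) pre_digraph \<Rightarrow> 'b set \<Rightarrow> nat \<Rightarrow> 'a set \<Rightarrow> 'b set set \<Rightarrow> nat"
  where "cover_value G F k U \<K> =
    k * (\<Sum>K\<in>\<K>. card (F \<inter> K)) + card (U - (\<Union>K\<in>\<K>. nodes_of G K))"

lemma (in fin_digraph) k_union_card_le_cover_value:
  assumes "finite U" "T \<subseteq> U" "k_union_F_stable G F k T" and \<K>: "\<K> \<subseteq> dicircuits G"
  shows "card T \<le> cover_value G F k U \<K>"
proof -
  let ?N = "\<Union>K\<in>\<K>. nodes_of G K"
  have "finite \<K>" using \<K> finite_dicircuits by (rule finite_subset)
  then have "card (\<Union>K\<in>\<K>. T \<inter> nodes_of G K) \<le> (\<Sum>K\<in>\<K>. card (T \<inter> nodes_of G K))"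
    by (rule card_UN_le)
  moreover have "(\<Union>K\<in>\<K>. T \<inter> nodes_of G K) = T \<inter> ?N" by blast
  ultimately have "card (T \<inter> ?N) \<le> (\<Sum>K\<in>\<K>. card (T \<inter> nodes_of G K))" by simp
  also have "\<dots> \<le> (\<Sum>K\<in>\<K>. k * card (F \<inter> K))"
    using k_union_dicircuit_bound[OF assms(3)] \<K> by (intro sum_mono) auto
  finally have "card (T \<inter> ?N) \<le> k * (\<Sum>K\<in>\<K>. card (F \<inter> K))"
    by (simp add: sum_distrib_left)
  moreover have "card (T - ?N) \<le> card (U - ?N)"
    using assms(1,2) by (intro card_mono) auto
  moreover have "card T = card (T \<inter> ?N) + card (T - ?N)"
    using finite_subset[OF assms(2,1)] by (simp add: card_Int_Diff)
  ultimately show ?thesis by (simp add: cover_value_def)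
qed

text \<open>
  With weights 0 and 1 multiplicities above 1 bring no gain, so \<open>y\<close> may be replaced by its
  support.
\<close>

lemma (in fin_digraph) cover_value_support_le_dual_value:
  assumes U: "U \<subseteq> verts G"
  shows "int (cover_value G F k U {K \<in> dicircuits G. y K > 0})
    \<le> dual_value G F k (\<lambda>v. of_bool (v \<in> U)) y"
proof -
  define \<K> where "\<K> = {K \<in> dicircuits G. y K > 0}"
  let ?N = "\<Union>K\<in>\<K>. nodes_of G K"
  have "(\<Sum>K\<in>\<K>. int (card (F \<inter> K))) \<le> (\<Sum>K\<in>\<K>. int (y K) * int (card (F \<inter> K)))"
    by (intro sum_mono) (auto simp: \<K>_def mult_le_cancel_right1)
  also have "\<dots> = (\<Sum>K\<in>dicircuits G. int (y K) * int (card (F \<inter> K)))"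
    using finite_dicircuits by (intro sum.mono_neutral_left) (auto simp: \<K>_def)
  finally have circuits: "int k * (\<Sum>K\<in>\<K>. int (card (F \<inter> K)))
      \<le> int k * (\<Sum>K\<in>dicircuits G. int (y K) * int (card (F \<inter> K)))"
    by (intro mult_left_mono) auto
  have "of_bool (v \<in> U - ?N) \<le> max (int (of_bool (v \<in> U))
      - (\<Sum>K | K \<in> dicircuits G \<and> v \<in> nodes_of G K. int (y K))) 0" for v
  proof (cases "v \<in> U - ?N")
    case True
    then have "(\<Sum>K | K \<in> dicircuits G \<and> v \<in> nodes_of G K. int (y K)) = 0"
      by (intro sum.neutral) (auto simp: \<K>_def)
    with True show ?thesis by simp
  qed auto
  then have "(\<Sum>v\<in>verts G. of_bool (v \<in> U - ?N)) \<le> (\<Sum>v\<in>verts G. max (int (of_bool (v \<in> U))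
      - (\<Sum>K | K \<in> dicircuits G \<and> v \<in> nodes_of G K. int (y K))) 0)"
    by (rule sum_mono)
  moreover have "(\<Sum>v\<in>verts G. of_bool (v \<in> U - ?N)) = int (card (U - ?N))"
  proof -
    have "verts G \<inter> {v. v \<in> U - ?N} = U - ?N" using U by auto
    then show ?thesis by (simp del: Diff_iff UN_iff)
  qed
  ultimately show ?thesis
    using circuits unfolding \<K>_def[symmetric] by (simp add: cover_value_def dual_value_def)
qed

lemma max_eq_min_of_weak_duality:
  assumes "\<And>x y. x \<in> X \<Longrightarrow> y \<in> Y \<Longrightarrow> x \<le> y" and "m \<in> X" and "m \<in> Y"
  shows "is_maximum m X \<and> is_minimum m Y"
  using assms by (auto simp: is_maximum_def is_minimum_def)

theorem theorem6p3:
  fixes G :: "('a, 'b) pre_digraph" and F :: "'b set" and k :: nat and w :: "'a \<Rightarrow> nat"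
  assumes "fin_digraph G" and "loopfree_digraph G"
    and "strongly_connected G" and "card (verts G) \<ge> 2"
    and "flat G F" and "k \<ge> 2"
  shows
    "(\<exists>m :: int.
        is_maximum m {\<Sum>v\<in>S. int (w v) | S. S \<subseteq> verts G \<and> k_union_F_stable G F k S} \<and>
        is_minimum m
          {int k * (\<Sum>K\<in>dicircuits G. int (y K) * int (card (F \<inter> K)))
             + (\<Sum>v\<in>verts G.
                  max (int (w v) - (\<Sum>K | K \<in> dicircuits G \<and> v \<in> nodes_of G K. int (y K))) 0)
           | y :: 'b set \<Rightarrow> nat. True})
     \<and>
     (\<forall>U \<subseteq> verts G. \<exists>m :: nat.
        is_maximum m {card S | S. S \<subseteq> U \<and> k_union_F_stable G F k S} \<and>
        is_minimum m
          {k * (\<Sum>K\<in>\<K>. card (F \<inter> K)) + card (U - (\<Union>K\<in>\<K>. nodes_of G K))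
           | \<K>. \<K> \<subseteq> dicircuits G})"
proof (intro conjI allI impI)
  interpret fin_digraph G by fact
  have "k > 0" using assms(6) by simp
  note attain = k_union_weight_attains_dual_value[OF assms(1-3,5) \<open>k > 0\<close>]
  let ?W = "{\<Sum>v\<in>S. int (w v) | S. S \<subseteq> verts G \<and> k_union_F_stable G F k S}"
  let ?D = "{dual_value G F k w y | y. True}"
  have le: "a \<le> d" if "a \<in> ?W" "d \<in> ?D" for a d
    using that k_union_weight_le_dual_value by blast
  obtain S y where S: "S \<subseteq> verts G" "k_union_F_stable G F k S"
    and eq: "(\<Sum>v\<in>S. int (w v)) = dual_value G F k w y"
    using attain by blast
  have "(\<Sum>v\<in>S. int (w v)) \<in> ?W" using S by blast
  moreover have "(\<Sum>v\<in>S. int (w v)) \<in> ?D" using eq by blast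
  ultimately have "is_maximum (\<Sum>v\<in>S. int (w v)) ?W \<and> is_minimum (\<Sum>v\<in>S. int (w v)) ?D"
    using le by (intro max_eq_min_of_weak_duality)
  then show "\<exists>m :: int.
        is_maximum m {\<Sum>v\<in>S. int (w v) | S. S \<subseteq> verts G \<and> k_union_F_stable G F k S} \<and>
        is_minimum m
          {int k * (\<Sum>K\<in>dicircuits G. int (y K) * int (card (F \<inter> K)))
             + (\<Sum>v\<in>verts G.
                  max (int (w v) - (\<Sum>K | K \<in> dicircuits G \<and> v \<in> nodes_of G K. int (y K))) 0)
           | y :: 'b set \<Rightarrow> nat. True}"
    unfolding dual_value_def by blast

  fix U assume U: "U \<subseteq> verts G"
  then have finU: "finite U" by (rule finite_subset) simp
  let ?C = "{card S | S. S \<subseteq> U \<and> k_union_F_stable G F k S}"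
  let ?E = "{cover_value G F k U \<K> | \<K>. \<K> \<subseteq> dicircuits G}"
  have le: "a \<le> d" if "a \<in> ?C" "d \<in> ?E" for a d
    using that k_union_card_le_cover_value[OF finU] by blast
  obtain S y where S: "S \<subseteq> verts G" "k_union_F_stable G F k S"
    and eq: "(\<Sum>v\<in>S. int (of_bool (v \<in> U))) = dual_value G F k (\<lambda>v. of_bool (v \<in> U)) y"
    using attain[of "\<lambda>v. of_bool (v \<in> U)"] by blast
  define \<K> where "\<K> = {K \<in> dicircuits G. y K > 0}"
  have SU: "S \<inter> U \<subseteq> U" "k_union_F_stable G F k (S \<inter> U)" and \<K>: "\<K> \<subseteq> dicircuits G"
    using k_union_F_stable_subset[OF S(2)] by (auto simp: \<K>_def)
  have "finite S" using S(1) by (rule finite_subset) simp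
  then have "int (card (S \<inter> U)) = dual_value G F k (\<lambda>v. of_bool (v \<in> U)) y"
    using eq by (simp add: Int_def)
  then have "cover_value G F k U \<K> \<le> card (S \<inter> U)"
    using cover_value_support_le_dual_value[OF U, of F k y] by (simp add: \<K>_def)
  with k_union_card_le_cover_value[OF finU SU \<K>]
  have "card (S \<inter> U) = cover_value G F k U \<K>" by simp
  then have "card (S \<inter> U) \<in> ?E" using \<K> by blast
  moreover have "card (S \<inter> U) \<in> ?C" using SU by blast
  ultimately have "is_maximum (card (S \<inter> U)) ?C \<and> is_minimum (card (S \<inter> U)) ?E"
    using le by (intro max_eq_min_of_weak_duality)
  then show "\<exists>m :: nat.
        is_maximum m {card S | S. S \<subseteq> U \<and> k_union_F_stable G F k S} \<and>
        is_minimum m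
          {k * (\<Sum>K\<in>\<K>. card (F \<inter> K)) + card (U - (\<Union>K\<in>\<K>. nodes_of G K))
           | \<K>. \<K> \<subseteq> dicircuits G}"
    unfolding cover_value_def by blast
qed

end
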